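(* Let $G$ be a finite group and $p$ a prime. Let $\Omega(G)$ be one of the following sets of subgroups of $G$: (i) the set of all pronormal subgroups of $G$; (ii) the set of all $\mathscr{H}$-subgroups of $G$; (iii) the set of all weakly normal subgroups of $G$; (iv) the set of all subgroups of $G$ satisfying the subnormalizer condition in $G$; (v) the set of all $NE$-subgroups of $G$. Let $\Omega_p(G)$ be the set of all $p$-groups in $\Omega(G)$. Let $N_{\Omega}(G)$ be the intersection of the normalizers in $G$ of all members of $\Omega(G)$, and let $N_{\Omega_p}(G)$ be the intersection of the normalizers in $G$ of all members of $\Omega_p(G)$. Then: (a) in each of the cases (i)--(v), $N_{\Omega}(G)$ coincides with the intersection of the normalizers $N_G(P)$ of all Sylow subgroups $P$ of $G$ (for all primes); (b) in each of the cases (i)--(iv), $N_{\Omega_p}(G)$ coincides with the intersection of the normalizers $N_G(P)$ of all Sylow $p$-subgroups $P$ of $G$.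
   Context: All groups are finite. For $H\leq G$ and $g\in G$, $H^g$ denotes the conjugate $g^{-1}Hg$, $N_G(H)$ the normalizer of $H$ in $G$, and $H^G$ the normal closure of $H$ in $G$. The intersection of normalizers over an empty set of subgroups is taken to be $G$. Definitions, for a subgroup $H$ of $G$: - $H$ is pronormal in $G$ if for every $g\in G$ there exists $x\in\langle H,H^g\rangle$ such that $H^x=H^g$. - $H$ is an $\mathscr{H}$-subgroup of $G$ if $N_G(H)\cap H^g\leq H$ for every $g\in G$. - $H$ is weakly normal in $G$ if, for every $g\in G$, $H^g\leq N_G(H)$ implies $g\in N_G(H)$. - $H$ satisfies the subnormalizer condition in $G$ if for every subgroup $K$ of $G$ such that $H\unlhd K$, one has $N_G(K)\leq N_G(H)$. - $H$ is an $NE$-subgroup of $G$ if $H=N_G(H)\cap H^G$. *)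

theory Defs
  imports "HOL-Algebra.Algebra"
begin

definition conj_subgroup :: "('a, 'b) monoid_scheme \<Rightarrow> 'a set \<Rightarrow> 'a \<Rightarrow> 'a set" where
  "conj_subgroup G H g = (inv\<^bsub>G\<^esub> g <#\<^bsub>G\<^esub> H) #>\<^bsub>G\<^esub> g"

definition normal_closure :: "('a, 'b) monoid_scheme \<Rightarrow> 'a set \<Rightarrow> 'a set" where
  "normal_closure G H = \<Inter> {N. N \<lhd> G \<and> H \<subseteq> N}"

definition pronormal_subgroups :: "('a, 'b) monoid_scheme \<Rightarrow> 'a set set" where
  "pronormal_subgroups G = {H. subgroup H G \<and>
     (\<forall>g \<in> carrier G. \<exists>x \<in> generate G (H \<union> conj_subgroup G H g).
        conj_subgroup G H x = conj_subgroup G H g)}"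

definition scrH_subgroups :: "('a, 'b) monoid_scheme \<Rightarrow> 'a set set" where
  "scrH_subgroups G = {H. subgroup H G \<and>
     (\<forall>g \<in> carrier G. normalizer G H \<inter> conj_subgroup G H g \<subseteq> H)}"

definition weakly_normal_subgroups :: "('a, 'b) monoid_scheme \<Rightarrow> 'a set set" where
  "weakly_normal_subgroups G = {H. subgroup H G \<and>
     (\<forall>g \<in> carrier G. conj_subgroup G H g \<subseteq> normalizer G H \<longrightarrow> g \<in> normalizer G H)}"

definition subnormalizer_subgroups :: "('a, 'b) monoid_scheme \<Rightarrow> 'a set set" where
  "subnormalizer_subgroups G = {H. subgroup H G \<and>
     (\<forall>K. subgroup K G \<and> H \<lhd> G\<lparr>carrier := K\<rparr> \<longrightarrow> normalizer G K \<subseteq> normalizer G H)}"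

definition NE_subgroups :: "('a, 'b) monoid_scheme \<Rightarrow> 'a set set" where
  "NE_subgroups G = {H. subgroup H G \<and> H = normalizer G H \<inter> normal_closure G H}"

definition sylow_subgroups :: "('a, 'b) monoid_scheme \<Rightarrow> nat \<Rightarrow> 'a set set" where
  "sylow_subgroups G p = {P. subgroup P G \<and> card P = p ^ multiplicity p (order G)}"

(* For a finite group G and a prime p. The trivial subgroup counts as a p-group. *)
definition p_members :: "nat \<Rightarrow> 'a set set \<Rightarrow> 'a set set" where
  "p_members p \<Omega> = {H \<in> \<Omega>. \<exists>k. card H = p ^ k}"

(* Intersecting with the carrier makes the value G when \<Omega> is empty. *)
definition normalizer_inter :: "('a, 'b) monoid_scheme \<Rightarrow> 'a set set \<Rightarrow> 'a set" where
  "normalizer_inter G \<Omega> = carrier G \<inter> (\<Inter>H \<in> \<Omega>. normalizer G H)"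

end

theory Submission
  imports Defs
begin

text \<open>
  Every pronormal subgroup, every \<open>\<H>\<close>-subgroup and every \<open>NE\<close>-subgroup satisfies the
  subnormalizer condition, so it suffices to bound the normalizers of subgroups \<open>H\<close> of the latter
  kind from below, and to note that Sylow subgroups \<open>P\<close> belong to the first four classes while
  \<open>N(P)\<close>, being self-normalizing, is an \<open>NE\<close>-subgroup with the same normalizer as \<open>P\<close>.

  If \<open>H\<close> is a \<open>p\<close>-group inside a Sylow subgroup \<open>P\<close>, then \<open>Q = P \<inter> N(H)\<close> satisfies
  \<open>N(Q) \<le> N(H)\<close>; since normalizers grow in \<open>p\<close>-groups, \<open>Q = P\<close> and hence \<open>N(P) \<le> N(H)\<close>.

  If \<open>H\<close> is arbitrary, then \<open>K = N(H)\<close> is self-normalizing, and the intersection \<open>Z\<close> of all Sylow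
  normalizers lies in every self-normalizing \<open>K\<close>: the Sylow \<open>q\<close>-subgroup of \<open>Z\<close> lies in the normal
  \<open>q\<close>-subgroup \<open>N = Z \<inter> O\<^sub>q(G)\<close>, which centralizes all elements of order prime to \<open>q\<close>.
  Were \<open>N\<close> not contained in \<open>K\<close>, with \<open>Q\<close> a Sylow \<open>q\<close>-subgroup of \<open>K\<close>, growth of normalizers in
  the \<open>q\<close>-group \<open>N Q\<close> would give an element of \<open>N\<close> outside \<open>K\<close> that normalizes \<open>Q\<close> and
  centralizes the other Sylow subgroups of \<open>K\<close>, hence normalizes \<open>K\<close>.
\<close>

section \<open>Actions of p-groups\<close>

lemma prime_power_dvd_imp:
  fixes p d :: nat
  assumes p: "Factorial_Ring.prime p" and d: "d dvd p ^ k"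
  shows "d = 1 \<or> p dvd d"
proof -
  obtain i where "d = p ^ i"
    using d p divides_primepow_nat by blast
  then show ?thesis by (cases i) auto
qed

text \<open>An orbit that meets the fixed points is a singleton; any other orbit has size different
  from 1 dividing \<open>p ^ k\<close>, hence divisible by \<open>p\<close>. The nonfixed points are
  the union of the orbits of the second kind.\<close>

lemma (in group_action) p_dvd_card_nonfixed:
  assumes p: "Factorial_Ring.prime p" and ord: "order G = p ^ k" and fin: "finite E"
  shows "p dvd card {x \<in> E. \<not> (\<forall>g \<in> carrier G. \<phi> g x = x)}"
proof -
  let ?F = "\<lambda>x. \<forall>g \<in> carrier G. \<phi> g x = x"
  \<comment> \<open>The indicator of the nonfixed points: its sum over \<open>E\<close> counts them
    and splits along the orbits.\<close>
  let ?f = "\<lambda>x. if ?F x then 0 else (1 :: nat)"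
  have fixed_orbit: "orbit G \<phi> x = {x}" if "x \<in> E" "?F x" for x
    using that orbit_refl[of x] by (auto simp: orbit_def)
  have "p dvd (\<Sum>x \<in> orb. ?f x)" if orb: "orb \<in> orbits G E \<phi>" for orb
  proof -
    obtain x where x: "x \<in> E" "orb = orbit G \<phi> x"
      using orb by (auto simp: orbits_def)
    have sub: "orb \<subseteq> E"
      using x element_image by (auto simp: orbit_def)
    show ?thesis
    proof (cases "\<exists>y \<in> orb. ?F y")
      case True
      then obtain y where y: "y \<in> orb" "?F y" by blast
      with sub x have "x \<in> orbit G \<phi> y"
        using orbit_sym by blast
      with y sub fixed_orbit[of y] have "x = y" by auto
      with y x fixed_orbit[of y] have "orb = {y}" by auto
      with y show ?thesis by simp
    next
      case False
      then have "(\<Sum>x \<in> orb. ?f x) = card orb"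
        unfolding card_eq_sum by (intro sum.cong) auto
      moreover have "card orb dvd p ^ k"
        using orbit_stabilizer_theorem[OF x(1)] ord x(2) by (metis dvd_triv_left)
      moreover have "card orb \<noteq> 1"
      proof
        assume "card orb = 1"
        then have "orb = {x}"
          using x orbit_refl[of x] by (metis card_1_singletonE singletonD)
        then have "?F x"
          using x by (auto simp: orbit_def)
        with False \<open>orb = {x}\<close> show False by blast
      qed
      ultimately show ?thesis
        using prime_power_dvd_imp[OF p] by metis
    qed
  qed
  then have "p dvd (\<Sum>orb \<in> orbits G E \<phi>. \<Sum>x \<in> orb. ?f x)"
    by (rule dvd_sum)
  also have "\<dots> = (\<Sum>x \<in> E. ?f x)"
    by (rule disjoint_sum[OF fin])
  also have "\<dots> = card {x \<in> E. \<not> ?F x}"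
    using fin by (simp add: sum.If_cases Int_def)
  finally show ?thesis .
qed

context group
begin

text \<open>Translating by \<open>inv g\<close> turns right multiplication into a left action, and
  restricting the maps to \<open>rcosets Q\<close> makes them elements of
  \<open>BijGroup\<close>.\<close>

lemma rcosets_action:
  assumes Q: "subgroup Q G"
  shows "group_action G (rcosets Q) (\<lambda>g. \<lambda>C \<in> rcosets Q. C #> inv g)"
proof -
  let ?E = "rcosets Q"
  let ?\<phi> = "\<lambda>g. \<lambda>C \<in> ?E. C #> inv g"
  have Qs: "Q \<subseteq> carrier G" by (rule subgroup.subset[OF Q])
  have mem: "C #> g \<in> ?E" if "C \<in> ?E" "g \<in> carrier G" for C g
    using that Qs by (auto simp: RCOSETS_def coset_mult_assoc)
  have sub: "C \<subseteq> carrier G" if "C \<in> ?E" for C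
    using that Qs r_coset_subset_G by (auto simp: RCOSETS_def)
  have cancel: "(C #> g) #> inv g = C" "(C #> inv g) #> g = C"
    if "C \<in> ?E" "g \<in> carrier G" for C g
    using that sub[OF that(1)] by (simp_all add: coset_mult_assoc coset_mult_one)
  have bij: "?\<phi> g \<in> carrier (BijGroup ?E)" if "g \<in> carrier G" for g
  proof -
    have "bij_betw (\<lambda>C. C #> inv g) ?E ?E"
      by (rule bij_betw_byWitness[where f' = "\<lambda>C. C #> g"]) (use that mem cancel in auto)
    then show ?thesis
      by (simp add: BijGroup_def Bij_def cong: bij_betw_cong)
  qed
  have "?\<phi> (g \<otimes> h) = ?\<phi> g \<otimes>\<^bsub>BijGroup ?E\<^esub> ?\<phi> h" if "g \<in> carrier G" "h \<in> carrier G" for g h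
  proof -
    have "?\<phi> (g \<otimes> h) = compose ?E (?\<phi> g) (?\<phi> h)"
      using that mem sub by (auto simp: compose_def fun_eq_iff inv_mult_group coset_mult_assoc)
    then show ?thesis
      using bij that by (simp add: BijGroup_def)
  qed
  then have "?\<phi> \<in> hom G (BijGroup ?E)"
    using bij by (simp add: hom_def)
  then show ?thesis
    by (simp add: group_action_def group_hom_def group_hom_axioms_def group_BijGroup is_group)
qed

text \<open>Turns fixed cosets into conjugation: if all of a subgroup \<open>R\<close> fixes the
  coset of \<open>x\<close>, then \<open>x\<close> conjugates \<open>R\<close> into
  \<open>Q\<close>.\<close>

lemma rcoset_fixed_iff:
  assumes Q: "subgroup Q G" and x: "x \<in> carrier G" and g: "g \<in> carrier G"
  shows "(Q #> x) #> inv g = Q #> x \<longleftrightarrow> x \<otimes> g \<otimes> inv x \<in> Q"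
proof -
  interpret Q: subgroup Q G by (rule Q)
  have "(Q #> x) #> inv g = Q #> x \<longleftrightarrow> Q #> (x \<otimes> inv g) = Q #> x"
    using x g by (simp add: coset_mult_assoc Q.subset)
  also have "\<dots> \<longleftrightarrow> x \<in> Q #> (x \<otimes> inv g)"
    using x g Q by (metis inv_closed m_closed rcos_self repr_independence)
  also have "\<dots> \<longleftrightarrow> x \<otimes> inv (x \<otimes> inv g) \<in> Q"
    using x g by (intro Q.rcos_module is_group) auto
  also have "x \<otimes> inv (x \<otimes> inv g) = x \<otimes> g \<otimes> inv x"
    using x g by (simp add: inv_mult_group m_assoc)
  finally show ?thesis .
qed

lemma p_dvd_card_nonfixed_rcosets:
  assumes fin: "finite (carrier G)" and p: "Factorial_Ring.prime p"
    and Q: "subgroup Q G" and R: "subgroup R G" "card R = p ^ k"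
  shows "p dvd card {C \<in> rcosets Q. \<not> (\<forall>g \<in> R. C #> inv g = C)}"
proof -
  interpret A: group_action "G\<lparr>carrier := R\<rparr>" "rcosets Q" "\<lambda>g. \<lambda>C \<in> rcosets Q. C #> inv g"
    using group_action.induced_action[OF rcosets_action[OF Q] R(1)] .
  have "finite (rcosets Q)"
    using rcosets_part_G[OF Q] fin by (metis finite_UnionD)
  from A.p_dvd_card_nonfixed[OF p _ this, of k] R(2)
  have "p dvd card {C \<in> rcosets Q. \<not> (\<forall>g \<in> R. (\<lambda>C \<in> rcosets Q. C #> inv g) C = C)}"
    by (simp add: order_def)
  also have "{C \<in> rcosets Q. \<not> (\<forall>g \<in> R. (\<lambda>C \<in> rcosets Q. C #> inv g) C = C)}
    = {C \<in> rcosets Q. \<not> (\<forall>g \<in> R. C #> inv g = C)}"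
    by auto
  finally show ?thesis .
qed

text \<open>The index of \<open>Q\<close> is prime to \<open>p\<close>, so not every coset of
  \<open>Q\<close> can be moved by the \<open>p\<close>-group \<open>R\<close>; a fixed coset
  supplies the conjugating element.\<close>

lemma p_subgroup_conj_into:
  assumes fin: "finite (carrier G)" and p: "Factorial_Ring.prime p"
    and Q: "subgroup Q G" "card Q = p ^ multiplicity p (order G)"
    and R: "subgroup R G" "card R = p ^ k"
  shows "\<exists>x \<in> carrier G. \<forall>r \<in> R. x \<otimes> r \<otimes> inv x \<in> Q"
proof (rule ccontr)
  assume *: "\<not> ?thesis"
  have "\<not> (\<forall>g \<in> R. C #> inv g = C)" if C: "C \<in> rcosets Q" for C
  proof -
    obtain x where x: "x \<in> carrier G" "C = Q #> x"
      using C unfolding RCOSETS_def by blast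
    then show ?thesis
      using * rcoset_fixed_iff[OF Q(1) x(1)] subgroup.subset[OF R(1)] by fast
  qed
  then have "{C \<in> rcosets Q. \<not> (\<forall>g \<in> R. C #> inv g = C)} = rcosets Q" by blast
  then have "p dvd card (rcosets Q)"
    using p_dvd_card_nonfixed_rcosets[OF fin p Q(1) R] by simp
  then have "p ^ Suc (multiplicity p (order G)) dvd order G"
    using lagrange[OF Q(1)] Q(2) by (metis mult_dvd_mono dvd_refl power_Suc)
  moreover have "order G \<noteq> 0"
    using fin order_gt_0_iff_finite by auto
  ultimately show False
    using p multiplicity_geI[of "order G" p "Suc (multiplicity p (order G))"] not_prime_unit[of p]
    by (metis Suc_n_not_le_n)
qed

text \<open>Let \<open>Q\<close> act on its own cosets. It fixes the coset \<open>Q\<close>, while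
  \<open>p\<close> divides both the index and the number of nonfixed cosets, so some further coset
  is fixed; its representatives normalize \<open>Q\<close> and lie outside \<open>Q\<close>.\<close>

lemma normalizer_grows:
  assumes fin: "finite (carrier G)" and p: "Factorial_Ring.prime p"
    and G: "order G = p ^ n" and Q: "subgroup Q G" "Q \<noteq> carrier G"
  shows "\<exists>x \<in> carrier G - Q. \<forall>r \<in> Q. x \<otimes> r \<otimes> inv x \<in> Q"
proof (rule ccontr)
  assume *: "\<not> ?thesis"
  have lag: "card (rcosets Q) * card Q = p ^ n"
    using lagrange[OF Q(1)] G by simp
  then obtain k where k: "card Q = p ^ k"
    using p by (metis divides_primepow_nat dvd_triv_right)
  have "p dvd card (rcosets Q)"
  proof (rule ccontr)
    assume "\<not> p dvd card (rcosets Q)"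
    moreover have "card (rcosets Q) dvd p ^ n"
      using lag by (metis dvd_triv_left)
    ultimately have "card (rcosets Q) = 1"
      using prime_power_dvd_imp[OF p] by metis
    then have "card Q = card (carrier G)"
      using lagrange[OF Q(1)] by (simp add: order_def)
    then show False
      using Q fin by (metis card_subset_eq subgroup.subset)
  qed
  \<comment> \<open>If no element outside \<open>Q\<close> normalizes it, \<open>Q\<close> is the
    only fixed coset, so \<open>p\<close> would divide both the index and the index minus
    one.\<close>
  moreover have "{C \<in> rcosets Q. \<not> (\<forall>g \<in> Q. C #> inv g = C)} = rcosets Q - {Q}"
  proof -
    have "(\<forall>g \<in> Q. C #> inv g = C) \<longleftrightarrow> C = Q" if C: "C \<in> rcosets Q" for C
    proof -
      obtain x where x: "x \<in> carrier G" "C = Q #> x"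
        using C unfolding RCOSETS_def by blast
      have "(\<forall>g \<in> Q. C #> inv g = C) \<longleftrightarrow> (\<forall>g \<in> Q. x \<otimes> g \<otimes> inv x \<in> Q)"
        using rcoset_fixed_iff[OF Q(1) x(1)] x(2) subgroup.subset[OF Q(1)] by auto
      also have "\<dots> \<longleftrightarrow> x \<in> Q"
        using * x(1) subgroup.m_closed[OF Q(1)] subgroup.m_inv_closed[OF Q(1)] by blast
      also have "\<dots> \<longleftrightarrow> C = Q"
        using x coset_join1 coset_join2 Q(1) subgroup.subset[OF Q(1)] rcos_self by metis
      finally show ?thesis .
    qed
    then show ?thesis by blast
  qed
  ultimately have "p dvd card (rcosets Q - {Q})" "p dvd card (rcosets Q)"
    using p_dvd_card_nonfixed_rcosets[OF fin p Q(1) Q(1) k] by simp_all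
  moreover have "Q \<in> rcosets Q" "finite (rcosets Q)"
    using subgroup.subgroup_in_rcosets[OF Q(1) is_group] rcosets_part_G[OF Q(1)] fin
    by (auto intro: finite_UnionD)
  then have "card (rcosets Q) = Suc (card (rcosets Q - {Q}))"
    by (metis card.remove)
  ultimately show False
    using p by (metis Suc_eq_plus1 dvd_add_right_iff nat_dvd_1_iff_1 not_prime_1)
qed

section \<open>Conjugates and normalizers\<close>

lemma conj_subgroup_eq_image: "conj_subgroup G H g = (\<lambda>h. inv g \<otimes> h \<otimes> g) ` H"
  by (auto simp: conj_subgroup_def l_coset_def r_coset_def)

lemma subgroup_conj_subgroup: "subgroup (conj_subgroup G H g) G"
  if "subgroup H G" "g \<in> carrier G"
  unfolding conj_subgroup_def using that by (rule subgroup_conjugation_is_surj1[rotated])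

lemma inv_cancel_left:
  assumes "g \<in> carrier G" "x \<in> carrier G"
  shows "g \<otimes> (inv g \<otimes> x) = x" "inv g \<otimes> (g \<otimes> x) = x"
  using assms by (simp_all add: m_assoc[symmetric])

lemma conj_subgroup_mem_iff:
  assumes H: "subgroup H G" and g: "g \<in> carrier G"
  shows "y \<in> conj_subgroup G H g \<longleftrightarrow> y \<in> carrier G \<and> g \<otimes> y \<otimes> inv g \<in> H"
proof
  assume "y \<in> conj_subgroup G H g"
  then show "y \<in> carrier G \<and> g \<otimes> y \<otimes> inv g \<in> H"
    using g subgroup.mem_carrier[OF H]
    by (auto simp: conj_subgroup_eq_image m_assoc inv_cancel_left)
next
  assume *: "y \<in> carrier G \<and> g \<otimes> y \<otimes> inv g \<in> H"
  then have "y = inv g \<otimes> (g \<otimes> y \<otimes> inv g) \<otimes> g"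
    using g by (simp add: m_assoc inv_cancel_left)
  with * show "y \<in> conj_subgroup G H g"
    unfolding conj_subgroup_eq_image by blast
qed

lemma card_conj_subgroup:
  assumes "subgroup H G" "g \<in> carrier G"
  shows "card (conj_subgroup G H g) = card H"
proof -
  have "inj_on (\<lambda>h. inv g \<otimes> h \<otimes> g) H"
    using assms(2) subgroup.mem_carrier[OF assms(1)]
    by (intro inj_on_inverseI[where g = "\<lambda>y. g \<otimes> y \<otimes> inv g"]) (simp add: m_assoc inv_cancel_left)
  then show ?thesis
    by (simp add: conj_subgroup_eq_image card_image)
qed

text \<open>The library's \<open>normalizer\<close> conjugates by \<open>g H g^-1\<close>,
  \<open>conj_subgroup\<close> by \<open>g^-1 H g\<close>; the two conventions agree because the
  normalizer is closed under inverses.\<close>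

lemma normalizer_iff_conj:
  assumes H: "subgroup H G"
  shows "g \<in> normalizer G H \<longleftrightarrow> g \<in> carrier G \<and> conj_subgroup G H g = H"
proof -
  have "g \<in> normalizer G H \<longleftrightarrow> g \<in> carrier G \<and> inv g \<in> normalizer G H"
    using normalizer_imp_subgroup[OF subgroup.subset[OF H]]
    by (metis inv_inv subgroup.m_inv_closed subgroup.mem_carrier)
  also have "\<dots> \<longleftrightarrow> g \<in> carrier G \<and> conj_subgroup G H g = H"
    using subgroup.subset[OF H]
    by (auto simp: normalizer_def stabilizer_def conj_subgroup_def)
  finally show ?thesis .
qed

lemma subgroup_normalizer: "subgroup (normalizer G H) G" if "subgroup H G"
  using normalizer_imp_subgroup subgroup.subset[OF that] .

lemma subgroup_le_normalizer: "H \<subseteq> normalizer G H" if "subgroup H G"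
  using subgroup.subset[OF normal_imp_subgroup[OF subgroup_in_normalizer[OF that]]] by simp

lemma subgroup_restrict_iff:
  assumes L: "subgroup L G"
  shows "subgroup H (G\<lparr>carrier := L\<rparr>) \<longleftrightarrow> subgroup H G \<and> H \<subseteq> L"
proof
  assume H: "subgroup H (G\<lparr>carrier := L\<rparr>)"
  show "subgroup H G \<and> H \<subseteq> L"
    using incl_subgroup[OF L H] subgroup.subset[OF H] by simp
qed (use subgroup_incl[OF _ L] in blast)

lemma normal_restrict_iff:
  assumes H: "subgroup H G" and K: "subgroup K G"
  shows "H \<lhd> G\<lparr>carrier := K\<rparr> \<longleftrightarrow> H \<subseteq> K \<and> (\<forall>x \<in> K. \<forall>h \<in> H. x \<otimes> h \<otimes> inv x \<in> H)"
proof -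
  interpret K: group "G\<lparr>carrier := K\<rparr>" by (rule subgroup_imp_group[OF K])
  show ?thesis
    using H by (auto simp: K.normal_inv_iff subgroup_restrict_iff[OF K] m_inv_consistent[OF K])
qed

text \<open>Serves to show that the intersection of all Sylow subgroups for one prime is
  normal.\<close>

lemma normal_Inter_conj_closed:
  assumes A: "A \<noteq> {}" "\<And>H. H \<in> A \<Longrightarrow> subgroup H G"
    and conj: "\<And>H g. H \<in> A \<Longrightarrow> g \<in> carrier G \<Longrightarrow> conj_subgroup G H g \<in> A"
  shows "\<Inter>A \<lhd> G"
  unfolding normal_inv_iff
proof (intro conjI ballI)
  show "subgroup (\<Inter>A) G"
    using A by (intro subgroups_Inter) auto
  fix x h assume x: "x \<in> carrier G" and h: "h \<in> \<Inter>A"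
  show "x \<otimes> h \<otimes> inv x \<in> \<Inter>A"
  proof
    fix H assume H: "H \<in> A"
    then have "h \<in> conj_subgroup G H x"
      using conj[OF H x] h by blast
    then show "x \<otimes> h \<otimes> inv x \<in> H"
      using conj_subgroup_mem_iff[OF A(2)[OF H] x] by blast
  qed
qed

lemma sylow_conj:
  assumes "P \<in> sylow_subgroups G q" "g \<in> carrier G"
  shows "conj_subgroup G P g \<in> sylow_subgroups G q"
  using assms by (simp add: sylow_subgroups_def card_conj_subgroup subgroup_conj_subgroup)

lemma subgroup_normalizer_inter:
  assumes "\<And>H. H \<in> \<Omega> \<Longrightarrow> subgroup H G"
  shows "subgroup (normalizer_inter G \<Omega>) G"
proof -
  have "subgroup (\<Inter>(insert (carrier G) (normalizer G ` \<Omega>))) G"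
    using assms subgroup_normalizer subgroup_self by (intro subgroups_Inter) auto
  then show ?thesis
    by (simp add: normalizer_inter_def)
qed

lemma card_subgroup_dvd:
  assumes "subgroup H G" "subgroup K G" "H \<subseteq> K"
  shows "card H dvd card K"
  using group.lagrange[OF subgroup_imp_group[OF assms(2)] subgroup_incl[OF assms]]
  by (simp add: order_def) (metis dvd_triv_right)

lemma sylow_restrict_iff:
  assumes L: "subgroup L G"
  shows "P \<in> sylow_subgroups (G\<lparr>carrier := L\<rparr>) q \<longleftrightarrow>
    subgroup P G \<and> P \<subseteq> L \<and> card P = q ^ multiplicity q (card L)"
  by (simp add: sylow_subgroups_def order_def subgroup_restrict_iff[OF L] conj_ac)

section \<open>First inclusions between the classes\<close>

text \<open>If \<open>H^g\<close> normalizes \<open>H\<close>, so does the join of \<open>H\<close>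
  and \<open>H^g\<close>, and with it the element \<open>x\<close> given by pronormality. Hence
  \<open>H^g = H^x = H\<close>.\<close>

lemma pronormal_le_weakly_normal: "pronormal_subgroups G \<subseteq> weakly_normal_subgroups G"
proof
  fix H assume "H \<in> pronormal_subgroups G"
  then have H: "subgroup H G"
    and pro: "\<And>g. g \<in> carrier G \<Longrightarrow> \<exists>x \<in> generate G (H \<union> conj_subgroup G H g).
      conj_subgroup G H x = conj_subgroup G H g"
    by (auto simp: pronormal_subgroups_def)
  have "g \<in> normalizer G H" if g: "g \<in> carrier G" and le: "conj_subgroup G H g \<subseteq> normalizer G H" for g
  proof -
    obtain x where x: "x \<in> generate G (H \<union> conj_subgroup G H g)"
        "conj_subgroup G H x = conj_subgroup G H g"
      using pro[OF g] by blast
    moreover have "generate G (H \<union> conj_subgroup G H g) \<subseteq> normalizer G H"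
      using le subgroup_le_normalizer[OF H] by (intro generate_subgroup_incl subgroup_normalizer[OF H]) auto
    ultimately have "conj_subgroup G H g = H"
      using normalizer_iff_conj[OF H] by blast
    with g show ?thesis
      using normalizer_iff_conj[OF H] by blast
  qed
  with H show "H \<in> weakly_normal_subgroups G"
    by (simp add: weakly_normal_subgroups_def)
qed

lemma conj_subgroup_le_normal_closure:
  assumes H: "subgroup H G" and g: "g \<in> carrier G"
  shows "conj_subgroup G H g \<subseteq> normal_closure G H"
  unfolding normal_closure_def
proof (rule Inter_greatest)
  fix N assume "N \<in> {N. N \<lhd> G \<and> H \<subseteq> N}"
  then have N: "N \<lhd> G" "H \<subseteq> N" by auto
  show "conj_subgroup G H g \<subseteq> N"
    using normal.inv_op_closed1[OF N(1) g] N(2) by (auto simp: conj_subgroup_eq_image)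
qed

lemma subgroup_le_normal_closure: "H \<subseteq> normal_closure G H"
  by (auto simp: normal_closure_def)

text \<open>Every conjugate of \<open>H\<close> lies in the normal closure, which meets the
  normalizer only in \<open>H\<close>.\<close>

lemma NE_le_scrH: "NE_subgroups G \<subseteq> scrH_subgroups G"
proof
  fix H assume "H \<in> NE_subgroups G"
  then have H: "subgroup H G" and NE: "normalizer G H \<inter> normal_closure G H = H"
    by (auto simp: NE_subgroups_def)
  have "normalizer G H \<inter> conj_subgroup G H g \<subseteq> H" if "g \<in> carrier G" for g
    using conj_subgroup_le_normal_closure[OF H that] NE by blast
  with H show "H \<in> scrH_subgroups G"
    by (simp add: scrH_subgroups_def)
qed

context
  assumes fin: "finite (carrier G)"
begin

lemma finite_subgroup: "finite H" if "subgroup H G"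
  using subgroup.subset[OF that] fin finite_subset by blast

text \<open>Conjugates have equal finite cardinality, so an inclusion between them is an
  equality.\<close>

lemma normalizer_iff_conj_le:
  assumes H: "subgroup H G"
  shows "g \<in> normalizer G H \<longleftrightarrow> g \<in> carrier G \<and> conj_subgroup G H g \<subseteq> H"
  unfolding normalizer_iff_conj[OF H]
  using card_subset_eq[OF finite_subgroup[OF H] _ card_conj_subgroup[OF H]] by blast

lemma normalizer_iff:
  assumes H: "subgroup H G"
  shows "g \<in> normalizer G H \<longleftrightarrow> g \<in> carrier G \<and> (\<forall>h \<in> H. g \<otimes> h \<otimes> inv g \<in> H)"
proof -
  have "g \<in> normalizer G H \<longleftrightarrow> g \<in> carrier G \<and> H \<subseteq> conj_subgroup G H g"
    using card_subset_eq[OF finite_subgroup[OF subgroup_conj_subgroup[OF H]], of g H]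
      card_conj_subgroup[OF H]
    by (auto simp: normalizer_iff_conj[OF H])
  then show ?thesis
    using conj_subgroup_mem_iff[OF H] subgroup.mem_carrier[OF H] by blast
qed

lemma normal_restrict_iff_normalizer:
  assumes H: "subgroup H G" and K: "subgroup K G"
  shows "H \<lhd> G\<lparr>carrier := K\<rparr> \<longleftrightarrow> H \<subseteq> K \<and> K \<subseteq> normalizer G H"
  unfolding normal_restrict_iff[OF H K] using normalizer_iff[OF H] subgroup.subset[OF K] by auto

text \<open>Conjugation maps \<open>\<Omega>\<close> into itself: \<open>z\<close> normalizes
  \<open>H^x\<close>, and carrying this back by \<open>x\<close> shows that \<open>x z x^-1\<close>
  normalizes \<open>H\<close>.\<close>

lemma normal_normalizer_inter:
  assumes sub: "\<And>H. H \<in> \<Omega> \<Longrightarrow> subgroup H G"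
    and conj: "\<And>H g. H \<in> \<Omega> \<Longrightarrow> g \<in> carrier G \<Longrightarrow> conj_subgroup G H g \<in> \<Omega>"
  shows "normalizer_inter G \<Omega> \<lhd> G"
  unfolding normal_inv_iff
proof (intro conjI ballI)
  show "subgroup (normalizer_inter G \<Omega>) G"
    by (rule subgroup_normalizer_inter[OF sub])
  fix x z assume x: "x \<in> carrier G" and z: "z \<in> normalizer_inter G \<Omega>"
  have zG: "z \<in> carrier G" using z by (simp add: normalizer_inter_def)
  have "x \<otimes> z \<otimes> inv x \<in> normalizer G H" if H: "H \<in> \<Omega>" for H
  proof -
    have "z \<in> normalizer G (conj_subgroup G H x)"
      using z conj[OF H x] by (auto simp: normalizer_inter_def)
    then have *: "z \<otimes> y \<otimes> inv z \<in> conj_subgroup G H x" if "y \<in> conj_subgroup G H x" for y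
      using normalizer_iff[OF subgroup_conj_subgroup[OF sub[OF H] x]] that by blast
    have "(x \<otimes> z \<otimes> inv x) \<otimes> h \<otimes> inv (x \<otimes> z \<otimes> inv x) \<in> H" if h: "h \<in> H" for h
    proof -
      have hG: "h \<in> carrier G" using subgroup.mem_carrier[OF sub[OF H] h] .
      have "inv x \<otimes> h \<otimes> x \<in> conj_subgroup G H x"
        using h by (auto simp: conj_subgroup_eq_image)
      from *[OF this] have "x \<otimes> (z \<otimes> (inv x \<otimes> h \<otimes> x) \<otimes> inv z) \<otimes> inv x \<in> H"
        using conj_subgroup_mem_iff[OF sub[OF H] x] by blast
      also have "x \<otimes> (z \<otimes> (inv x \<otimes> h \<otimes> x) \<otimes> inv z) \<otimes> inv x
          = (x \<otimes> z \<otimes> inv x) \<otimes> h \<otimes> inv (x \<otimes> z \<otimes> inv x)"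
        using x zG hG by (simp add: m_assoc inv_mult_group)
      finally show ?thesis .
    qed
    then show ?thesis
      using normalizer_iff[OF sub[OF H]] x zG by simp
  qed
  then show "x \<otimes> z \<otimes> inv x \<in> normalizer_inter G \<Omega>"
    using x zG by (simp add: normalizer_inter_def)
qed

section \<open>Sylow subgroups of subgroups\<close>

lemma sylow_exists:
  assumes q: "Factorial_Ring.prime q" and L: "subgroup L G"
  obtains P where "P \<in> sylow_subgroups (G\<lparr>carrier := L\<rparr>) q"
proof -
  obtain m where "card L = q ^ multiplicity q (card L) * m"
    using multiplicity_dvd[of q "card L"] by (auto elim: dvdE)
  then have "\<exists>P. subgroup P (G\<lparr>carrier := L\<rparr>) \<and> card P = q ^ multiplicity q (card L)"
    using q finite_subgroup[OF L] subgroup_imp_group[OF L]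
    by (intro sylow_thm[where m = m]) (auto simp: order_def)
  then show ?thesis
    using that by (auto simp: sylow_subgroups_def order_def)
qed

lemma sylow_maximal:
  assumes q: "Factorial_Ring.prime q" and L: "subgroup L G"
    and Q: "Q \<in> sylow_subgroups (G\<lparr>carrier := L\<rparr>) q"
    and R: "subgroup R G" "card R = q ^ k" "Q \<subseteq> R" "R \<subseteq> L"
  shows "R = Q"
proof -
  have "q ^ k dvd card L"
    using card_subgroup_dvd[OF R(1) L R(4)] R(2) by simp
  moreover have "card L \<noteq> 0"
    using finite_subgroup[OF L] subgroup.one_closed[OF L] by auto
  ultimately have "k \<le> multiplicity q (card L)"
    using q by (intro multiplicity_geI) auto
  then have "card R \<le> card Q"
    using Q R(2) q prime_gt_0_nat[OF q]
    by (auto simp: sylow_restrict_iff[OF L] intro!: power_increasing)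
  then show ?thesis
    using card_seteq[OF finite_subgroup[OF R(1)] R(3)] by simp
qed

text \<open>Working inside \<open>L\<close> yields a conjugating element in \<open>L\<close> itself;
  pronormality of Sylow subgroups depends on this.\<close>

lemma sylow_conj_into:
  assumes q: "Factorial_Ring.prime q" and L: "subgroup L G"
    and Q: "Q \<in> sylow_subgroups (G\<lparr>carrier := L\<rparr>) q"
    and R: "subgroup R G" "card R = q ^ k" "R \<subseteq> L"
  shows "\<exists>x \<in> L. \<forall>r \<in> R. x \<otimes> r \<otimes> inv x \<in> Q"
proof -
  have "\<exists>x \<in> carrier (G\<lparr>carrier := L\<rparr>). \<forall>r \<in> R.
      x \<otimes>\<^bsub>G\<lparr>carrier := L\<rparr>\<^esub> r \<otimes>\<^bsub>G\<lparr>carrier := L\<rparr>\<^esub> inv\<^bsub>G\<lparr>carrier := L\<rparr>\<^esub> x \<in> Q"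
  proof (rule group.p_subgroup_conj_into[OF subgroup_imp_group[OF L] _ q])
    show "finite (carrier (G\<lparr>carrier := L\<rparr>))"
      using finite_subgroup[OF L] by simp
    show "subgroup R (G\<lparr>carrier := L\<rparr>)"
      by (rule subgroup_incl[OF R(1) L R(3)])
  qed (use Q R(2) in \<open>simp_all add: sylow_subgroups_def\<close>)
  then show ?thesis
    using m_inv_consistent[OF L] by auto
qed

text \<open>By Lagrange, \<open>card P\<close> divides \<open>card L\<close> and
  \<open>card L\<close> divides \<open>order G\<close>, so both orders have the same
  \<open>q\<close>-part.\<close>

lemma sylow_of_intermediate:
  assumes q: "Factorial_Ring.prime q" and P: "P \<in> sylow_subgroups G q"
    and L: "subgroup L G" "P \<subseteq> L"
  shows "P \<in> sylow_subgroups (G\<lparr>carrier := L\<rparr>) q"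
proof -
  have Ps: "subgroup P G" and Pc: "card P = q ^ multiplicity q (order G)"
    using P by (auto simp: sylow_subgroups_def)
  have "order G \<noteq> 0" using fin order_gt_0_iff_finite by auto
  then have "multiplicity q (card L) \<le> multiplicity q (order G)"
    using card_subgroup_dvd[OF L(1) subgroup_self] subgroup.subset[OF L(1)]
    by (auto simp: order_def intro!: dvd_imp_multiplicity_le)
  moreover have "multiplicity q (order G) \<le> multiplicity q (card L)"
    using card_subgroup_dvd[OF Ps L] Pc q finite_subgroup[OF L(1)] subgroup.one_closed[OF L(1)]
    by (intro multiplicity_geI) auto
  ultimately show ?thesis
    using Ps Pc L by (simp add: sylow_restrict_iff)
qed

text \<open>\<open>P\<close> is a Sylow subgroup of its normalizer, so some \<open>x\<close> there
  conjugates \<open>R\<close> into \<open>P\<close>; then \<open>R\<close> lies in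
  \<open>P^x = P\<close>.\<close>

lemma p_subgroup_le_normal_sylow:
  assumes q: "Factorial_Ring.prime q" and P: "P \<in> sylow_subgroups G q"
    and R: "subgroup R G" "card R = q ^ k" "R \<subseteq> normalizer G P"
  shows "R \<subseteq> P"
proof -
  have Ps: "subgroup P G"
    using P by (simp add: sylow_subgroups_def)
  let ?N = "normalizer G P"
  have N: "subgroup ?N G" by (rule subgroup_normalizer[OF Ps])
  have "P \<in> sylow_subgroups (G\<lparr>carrier := ?N\<rparr>) q"
    using sylow_of_intermediate[OF q P N subgroup_le_normalizer[OF Ps]] .
  from sylow_conj_into[OF q N this R]
  obtain x where x: "x \<in> ?N" "\<And>r. r \<in> R \<Longrightarrow> x \<otimes> r \<otimes> inv x \<in> P" by blast
  then have "R \<subseteq> conj_subgroup G P x"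
    using conj_subgroup_mem_iff[OF Ps] normalizer_iff[OF Ps] subgroup.subset[OF R(1)] by blast
  then show ?thesis
    using x(1) normalizer_iff_conj[OF Ps] by blast
qed

lemma p_subgroup_le_sylow:
  assumes q: "Factorial_Ring.prime q" and R: "subgroup R G" "card R = q ^ k"
  obtains P where "P \<in> sylow_subgroups G q" "R \<subseteq> P"
proof -
  obtain P where P: "P \<in> sylow_subgroups G q"
    using sylow_exists[OF q subgroup_self] by auto
  then have Ps: "subgroup P G" by (simp add: sylow_subgroups_def)
  obtain x where x: "x \<in> carrier G" "\<And>r. r \<in> R \<Longrightarrow> x \<otimes> r \<otimes> inv x \<in> P"
    using sylow_conj_into[OF q subgroup_self _ R subgroup.subset[OF R(1)], of P] P by auto
  then have "R \<subseteq> conj_subgroup G P x"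
    using conj_subgroup_mem_iff[OF Ps x(1)] subgroup.subset[OF R(1)] by blast
  with that sylow_conj[OF P x(1)] show ?thesis by blast
qed

text \<open>For each prime, the order of \<open>L \<inter> S\<close> is divisible by the full prime
  power in \<open>card L\<close>. Hence \<open>card L\<close> divides
  \<open>card (L \<inter> S)\<close>, which forces equality.\<close>

lemma subgroup_le_if_sylow_le:
  assumes L: "subgroup L G" and S: "subgroup S G"
    and syl: "\<And>q. Factorial_Ring.prime q \<Longrightarrow>
      \<exists>Q \<in> sylow_subgroups (G\<lparr>carrier := L\<rparr>) q. Q \<subseteq> S"
  shows "L \<subseteq> S"
proof -
  have LS: "subgroup (L \<inter> S) G" by (rule subgroups_Inter_pair[OF L S])
  then have nz: "card (L \<inter> S) \<noteq> 0" "card L \<noteq> 0"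
    using finite_subgroup[OF LS] finite_subgroup[OF L] subgroup.one_closed[OF LS] subgroup.one_closed[OF L]
    by auto
  have "multiplicity q (card L) \<le> multiplicity q (card (L \<inter> S))" if q: "Factorial_Ring.prime q" for q
  proof -
    obtain Q where Q: "subgroup Q G" "Q \<subseteq> L \<inter> S" "card Q = q ^ multiplicity q (card L)"
      using syl[OF q] sylow_restrict_iff[OF L] by auto
    show ?thesis
      using card_subgroup_dvd[OF Q(1) LS Q(2)] Q(3) nz q by (intro multiplicity_geI) auto
  qed
  then have "card L dvd card (L \<inter> S)"
    using nz by (intro multiplicity_le_imp_dvd) auto
  then have "card L \<le> card (L \<inter> S)"
    using nz by (intro dvd_imp_le) auto
  then have "L \<inter> S = L"
    using finite_subgroup[OF L] by (intro card_seteq) auto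
  then show ?thesis by blast
qed

section \<open>Sylow subgroups and the five classes\<close>

text \<open>\<open>P\<close> and \<open>P^g\<close> are both Sylow subgroups of their join, hence
  conjugate by an element of the join.\<close>

lemma sylow_pronormal:
  assumes q: "Factorial_Ring.prime q" and P: "P \<in> sylow_subgroups G q"
  shows "P \<in> pronormal_subgroups G"
proof -
  have Ps: "subgroup P G" using P by (simp add: sylow_subgroups_def)
  have "\<exists>x \<in> generate G (P \<union> conj_subgroup G P g). conj_subgroup G P x = conj_subgroup G P g"
    if g: "g \<in> carrier G" for g
  proof -
    let ?R = "conj_subgroup G P g"
    let ?J = "generate G (P \<union> ?R)"
    have R: "subgroup ?R G" by (rule subgroup_conj_subgroup[OF Ps g])
    have J: "subgroup ?J G"
      using subgroup.subset[OF Ps] subgroup.subset[OF R] by (intro generate_is_subgroup) auto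
    have sub: "P \<subseteq> ?J" "?R \<subseteq> ?J" by (auto intro: generate.incl)
    have cR: "card ?R = q ^ multiplicity q (order G)"
      using P card_conj_subgroup[OF Ps g] by (simp add: sylow_subgroups_def)
    obtain x where x: "x \<in> ?J" "\<And>r. r \<in> ?R \<Longrightarrow> x \<otimes> r \<otimes> inv x \<in> P"
      using sylow_conj_into[OF q J sylow_of_intermediate[OF q P J sub(1)] R cR sub(2)] by blast
    have xG: "x \<in> carrier G" using subgroup.mem_carrier[OF J x(1)] .
    have "?R \<subseteq> conj_subgroup G P x"
      using x(2) conj_subgroup_mem_iff[OF Ps xG] subgroup.subset[OF R] by blast
    then have "conj_subgroup G P x = ?R"
      using card_subset_eq[OF finite_subgroup[OF subgroup_conj_subgroup[OF Ps xG]]]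
        card_conj_subgroup[OF Ps xG] card_conj_subgroup[OF Ps g] by metis
    with x(1) show ?thesis by blast
  qed
  with Ps show ?thesis
    by (simp add: pronormal_subgroups_def)
qed

text \<open>The intersection of \<open>P^g\<close> with the normalizer of \<open>P\<close> is a
  \<open>q\<close>-group normalizing \<open>P\<close>, and such a group lies in
  \<open>P\<close>.\<close>

lemma sylow_scrH:
  assumes q: "Factorial_Ring.prime q" and P: "P \<in> sylow_subgroups G q"
  shows "P \<in> scrH_subgroups G"
proof -
  have Ps: "subgroup P G" and Pc: "card P = q ^ multiplicity q (order G)"
    using P by (auto simp: sylow_subgroups_def)
  have "normalizer G P \<inter> conj_subgroup G P g \<subseteq> P" if g: "g \<in> carrier G" for g
  proof -
    let ?C = "conj_subgroup G P g"
    let ?R = "normalizer G P \<inter> ?C"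
    have C: "subgroup ?C G" by (rule subgroup_conj_subgroup[OF Ps g])
    have R: "subgroup ?R G"
      by (rule subgroups_Inter_pair[OF subgroup_normalizer[OF Ps] C])
    have "card ?R dvd q ^ multiplicity q (order G)"
      using card_subgroup_dvd[OF R C] card_conj_subgroup[OF Ps g] Pc by simp
    then obtain k where "card ?R = q ^ k"
      using q divides_primepow_nat by blast
    then show ?thesis
      using p_subgroup_le_normal_sylow[OF q P R] by blast
  qed
  with Ps show ?thesis
    by (simp add: scrH_subgroups_def)
qed

lemma scrH_le_weakly_normal: "scrH_subgroups G \<subseteq> weakly_normal_subgroups G"
proof
  fix H assume "H \<in> scrH_subgroups G"
  then have H: "subgroup H G"
    and sH: "\<And>g. g \<in> carrier G \<Longrightarrow> normalizer G H \<inter> conj_subgroup G H g \<subseteq> H"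
    by (auto simp: scrH_subgroups_def)
  have "g \<in> normalizer G H" if "g \<in> carrier G" "conj_subgroup G H g \<subseteq> normalizer G H" for g
    using sH[OF that(1)] that normalizer_iff_conj_le[OF H] by blast
  with H show "H \<in> weakly_normal_subgroups G"
    by (simp add: weakly_normal_subgroups_def)
qed

text \<open>If \<open>H\<close> is normal in \<open>K\<close> and \<open>g\<close> normalizes
  \<open>K\<close>, then \<open>H^g\<close> lies in \<open>K^g = K\<close>, which normalizes
  \<open>H\<close>; weak normality applies to \<open>g\<close>.\<close>

lemma weakly_normal_le_subnormalizer: "weakly_normal_subgroups G \<subseteq> subnormalizer_subgroups G"
proof
  fix H assume "H \<in> weakly_normal_subgroups G"
  then have H: "subgroup H G"
    and wn: "\<And>g. g \<in> carrier G \<Longrightarrow> conj_subgroup G H g \<subseteq> normalizer G H \<Longrightarrow> g \<in> normalizer G H"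
    by (auto simp: weakly_normal_subgroups_def)
  have "normalizer G K \<subseteq> normalizer G H" if K: "subgroup K G" "H \<lhd> G\<lparr>carrier := K\<rparr>" for K
  proof
    fix g assume g: "g \<in> normalizer G K"
    have HK: "H \<subseteq> K" "K \<subseteq> normalizer G H"
      using normal_restrict_iff_normalizer[OF H K(1)] K(2) by auto
    have "conj_subgroup G H g \<subseteq> conj_subgroup G K g"
      using HK(1) by (auto simp: conj_subgroup_eq_image)
    then show "g \<in> normalizer G H"
      using g HK(2) normalizer_iff_conj[OF K(1)] wn by blast
  qed
  with H show "H \<in> subnormalizer_subgroups G"
    by (simp add: subnormalizer_subgroups_def)
qed

lemma subnormalizer_normalizer_le:
  assumes H: "H \<in> subnormalizer_subgroups G"
    and K: "subgroup K G" "H \<subseteq> K" "K \<subseteq> normalizer G H"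
  shows "normalizer G K \<subseteq> normalizer G H"
proof -
  have "subgroup H G" using H by (simp add: subnormalizer_subgroups_def)
  then have "H \<lhd> G\<lparr>carrier := K\<rparr>"
    using normal_restrict_iff_normalizer[OF _ K(1)] K by blast
  with H K(1) show ?thesis
    unfolding subnormalizer_subgroups_def by blast
qed

lemma normalizer_self_normalizing:
  assumes H: "H \<in> subnormalizer_subgroups G"
  shows "normalizer G (normalizer G H) = normalizer G H"
proof -
  have Hs: "subgroup H G" using H by (simp add: subnormalizer_subgroups_def)
  note N = subgroup_normalizer[OF Hs]
  show ?thesis
    by (rule subset_antisym[OF
          subnormalizer_normalizer_le[OF H N subgroup_le_normalizer[OF Hs] order_refl]
          subgroup_le_normalizer[OF N]])
qed

text \<open>The normalizer of \<open>H\<close> is its own normalizer and lies in its own normal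
  closure, so the defining intersection is the subgroup itself.\<close>

lemma normalizer_mem_NE:
  assumes H: "H \<in> subnormalizer_subgroups G"
  shows "normalizer G H \<in> NE_subgroups G"
proof -
  have "subgroup (normalizer G H) G"
    using H by (simp add: subnormalizer_subgroups_def subgroup_normalizer)
  moreover have "normalizer G H \<inter> normal_closure G (normalizer G H) = normalizer G H"
    by (rule Int_absorb2[OF subgroup_le_normal_closure])
  ultimately show ?thesis
    unfolding NE_subgroups_def mem_Collect_eq normalizer_self_normalizing[OF H] by metis
qed

lemma normalizer_grows_in_p_subgroup:
  assumes p: "Factorial_Ring.prime p" and P: "subgroup P G" "card P = p ^ n"
    and Q: "subgroup Q G" "Q \<subset> P"
  obtains x where "x \<in> P - Q" "x \<in> normalizer G Q"
proof -
  have "\<exists>x \<in> carrier (G\<lparr>carrier := P\<rparr>) - Q. \<forall>r \<in> Q.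
      x \<otimes>\<^bsub>G\<lparr>carrier := P\<rparr>\<^esub> r \<otimes>\<^bsub>G\<lparr>carrier := P\<rparr>\<^esub> inv\<^bsub>G\<lparr>carrier := P\<rparr>\<^esub> x \<in> Q"
  proof (rule group.normalizer_grows[OF subgroup_imp_group[OF P(1)] _ p])
    show "finite (carrier (G\<lparr>carrier := P\<rparr>))"
      using finite_subgroup[OF P(1)] by simp
    show "order (G\<lparr>carrier := P\<rparr>) = p ^ n"
      using P(2) by (simp add: order_def)
    show "subgroup Q (G\<lparr>carrier := P\<rparr>)"
      using subgroup_incl[OF Q(1) P(1)] Q(2) by blast
  qed (use Q(2) in auto)
  then obtain x where x: "x \<in> P - Q" "\<forall>r \<in> Q. x \<otimes> r \<otimes> inv x \<in> Q"
    using m_inv_consistent[OF P(1)] by auto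
  then have "x \<in> normalizer G Q"
    using normalizer_iff[OF Q(1)] subgroup.mem_carrier[OF P(1)] by blast
  with x(1) that show ?thesis by blast
qed

section \<open>p-subgroups with the subnormalizer condition\<close>

lemma p_subnormalizer_normalizer:
  assumes p: "Factorial_Ring.prime p"
    and H: "H \<in> subnormalizer_subgroups G" "card H = p ^ k"
  shows "\<exists>P \<in> sylow_subgroups G p. normalizer G P \<subseteq> normalizer G H"
proof -
  have Hs: "subgroup H G" using H(1) by (simp add: subnormalizer_subgroups_def)
  obtain P where P: "P \<in> sylow_subgroups G p" "H \<subseteq> P"
    using p_subgroup_le_sylow[OF p Hs H(2)] .
  then have Ps: "subgroup P G" and Pc: "card P = p ^ multiplicity p (order G)"
    by (auto simp: sylow_subgroups_def)
  let ?Q = "P \<inter> normalizer G H"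
  have Q: "subgroup ?Q G"
    by (rule subgroups_Inter_pair[OF Ps subgroup_normalizer[OF Hs]])
  have HQ: "H \<subseteq> ?Q" using P(2) subgroup_le_normalizer[OF Hs] by blast
  have NQ: "normalizer G ?Q \<subseteq> normalizer G H"
    by (rule subnormalizer_normalizer_le[OF H(1) Q HQ]) simp
  have "?Q = P"
  proof (rule ccontr)
    \<comment> \<open>An element of \<open>P\<close> outside \<open>?Q\<close> normalizing
      \<open>?Q\<close> would normalize \<open>H\<close> by \<open>NQ\<close>, hence lie in
      \<open>?Q\<close> after all.\<close>
    assume "?Q \<noteq> P"
    then have "?Q \<subset> P" by blast
    from normalizer_grows_in_p_subgroup[OF p Ps Pc Q this]
    obtain x where "x \<in> P - ?Q" "x \<in> normalizer G ?Q" .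
    with NQ show False by blast
  qed
  with NQ P(1) show ?thesis by auto
qed

section \<open>Sylow normalizers and self-normalizing subgroups\<close>

lemma p_group_q_group_inter:
  assumes pq: "Factorial_Ring.prime p" "Factorial_Ring.prime q" "p \<noteq> q"
    and A: "subgroup A G" "card A = p ^ m" and B: "subgroup B G" "card B = q ^ n"
  shows "A \<inter> B = {\<one>}"
proof -
  have AB: "subgroup (A \<inter> B) G" by (rule subgroups_Inter_pair[OF A(1) B(1)])
  have "coprime (p ^ m) (q ^ n)"
    using primes_coprime[OF pq] by simp
  moreover have "card (A \<inter> B) dvd p ^ m" "card (A \<inter> B) dvd q ^ n"
    using card_subgroup_dvd[OF AB A(1)] card_subgroup_dvd[OF AB B(1)] A(2) B(2) by auto
  ultimately have "card (A \<inter> B) = 1"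
    using coprime_common_divisor_nat by blast
  then show ?thesis
    using subgroup.one_closed[OF AB] by (metis card_1_singletonE singletonD)
qed

lemma sylow_normalizer_inter_le_self_normalizing:
  assumes K: "subgroup K G" "normalizer G K \<subseteq> K"
  shows "normalizer_inter G (\<Union>q \<in> {q. Factorial_Ring.prime q}. sylow_subgroups G q) \<subseteq> K"
proof -
  let ?S = "\<Union>q \<in> {q. Factorial_Ring.prime q}. sylow_subgroups G q"
  let ?Z = "normalizer_inter G ?S"
  have S: "subgroup P G" if "P \<in> ?S" for P
    using that by (auto simp: sylow_subgroups_def)
  have Z: "?Z \<lhd> G"
  proof (rule normal_normalizer_inter[OF S])
    show "conj_subgroup G P g \<in> ?S" if "P \<in> ?S" "g \<in> carrier G" for P g
      using that sylow_conj by blast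
  qed
  then have Zs: "subgroup ?Z G" by (rule normal_imp_subgroup)
  show ?thesis
  proof (rule subgroup_le_if_sylow_le[OF Zs K(1)])
    fix q :: nat assume q: "Factorial_Ring.prime q"
    \<comment> \<open>The intersection of all Sylow \<open>q\<close>-subgroups is the largest normal
      \<open>q\<close>-subgroup of \<open>G\<close>. Thus \<open>?N\<close> is a normal
      \<open>q\<close>-subgroup of \<open>G\<close> whose elements normalize every Sylow
      subgroup.\<close>
    let ?N = "?Z \<inter> \<Inter>(sylow_subgroups G q)"
    obtain P0 where P0: "P0 \<in> sylow_subgroups G q"
      using sylow_exists[OF q subgroup_self] by auto
    have core: "\<Inter>(sylow_subgroups G q) \<lhd> G"
    proof (rule normal_Inter_conj_closed)
      show "sylow_subgroups G q \<noteq> {}" using P0 by blast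
      show "subgroup P G" if "P \<in> sylow_subgroups G q" for P
        using that by (simp add: sylow_subgroups_def)
    qed (rule sylow_conj)
    have N: "subgroup ?N G"
      by (rule subgroups_Inter_pair[OF Zs normal_imp_subgroup[OF core]])
    have Nn: "?N \<lhd> G"
      using Z core N by (auto simp: normal_inv_iff)
    have NP: "?N \<subseteq> P" if "P \<in> sylow_subgroups G q" for P
      using that by blast
    have "?N \<subseteq> K"
    proof (rule ccontr)
      assume notK: "\<not> ?N \<subseteq> K"
      obtain Q where Q: "Q \<in> sylow_subgroups (G\<lparr>carrier := K\<rparr>) q"
        using sylow_exists[OF q K(1)] .
      then have Qs: "subgroup Q G" "Q \<subseteq> K" "card Q = q ^ multiplicity q (card K)"
        using sylow_restrict_iff[OF K(1)] by auto
      obtain P where P: "P \<in> sylow_subgroups G q" "Q \<subseteq> P"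
        using p_subgroup_le_sylow[OF q Qs(1,3)] .
      then have Ps: "subgroup P G" and Pc: "card P = q ^ multiplicity q (order G)"
        by (auto simp: sylow_subgroups_def)
      \<comment> \<open>The product is a subgroup because \<open>?N\<close> is normal, and a
        \<open>q\<close>-group because both factors lie in \<open>P\<close>. It properly contains
        \<open>Q\<close>, since \<open>?N\<close> is not inside \<open>K\<close>.\<close>
      let ?L = "?N <#> Q"
      have L: "subgroup ?L G" by (rule mult_norm_subgroup[OF Nn Qs(1)])
      have LP: "?L \<subseteq> P"
        using NP[OF P(1)] P(2) subgroup.m_closed[OF Ps] by (auto simp: set_mult_def)
      have QL: "Q \<subseteq> ?L"
      proof
        fix s assume "s \<in> Q"
        moreover from this have "s = \<one> \<otimes> s" using subgroup.mem_carrier[OF Qs(1)] by simp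
        ultimately show "s \<in> ?L"
          using subgroup.one_closed[OF N] unfolding set_mult_def by blast
      qed
      have NL: "?N \<subseteq> ?L"
      proof
        fix s assume s: "s \<in> ?N"
        then have "s = s \<otimes> \<one>" using subgroup.mem_carrier[OF N] by simp
        with s show "s \<in> ?L"
          using subgroup.one_closed[OF Qs(1)] unfolding set_mult_def by blast
      qed
      have "card ?L dvd q ^ multiplicity q (order G)"
        using card_subgroup_dvd[OF L Ps LP] Pc by simp
      then obtain k where k: "card ?L = q ^ k"
        using q divides_primepow_nat by blast
      have "Q \<subset> ?L"
        using QL NL notK Qs(2) by blast
      from normalizer_grows_in_p_subgroup[OF q L k Qs(1) this]
      obtain x where x: "x \<in> ?L - Q" "x \<in> normalizer G Q" .
      \<comment> \<open>The factor \<open>s\<close> lies in \<open>Q\<close>, so it can be stripped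
        from \<open>x\<close>: the remaining \<open>m\<close> in \<open>?N\<close> still normalizes
        \<open>Q\<close> and still lies outside \<open>Q\<close>.\<close>
      then obtain m s where ms: "m \<in> ?N" "s \<in> Q" "x = m \<otimes> s"
        by (auto simp: set_mult_def)
      have mG: "m \<in> carrier G" and sG: "s \<in> carrier G"
        using subgroup.mem_carrier[OF N ms(1)] subgroup.mem_carrier[OF Qs(1) ms(2)] .
      have mQ: "m \<notin> Q"
        using x(1) ms subgroup.m_closed[OF Qs(1)] by blast
      have "m = x \<otimes> inv s"
        using ms(3) mG sG by (simp add: m_assoc)
      moreover have "inv s \<in> normalizer G Q"
        using subgroup_le_normalizer[OF Qs(1)] subgroup.m_inv_closed[OF Qs(1) ms(2)] by blast
      ultimately have mN: "m \<in> normalizer G Q"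
        using x(2) subgroup.m_closed[OF subgroup_normalizer[OF Qs(1)]] by blast
      let ?C = "conj_subgroup G K m"
      have C: "subgroup ?C G" by (rule subgroup_conj_subgroup[OF K(1) mG])
      \<comment> \<open>One Sylow subgroup of \<open>K\<close> per prime is enough: for
        \<open>q\<close> take \<open>Q\<close>, normalized by \<open>m\<close>; for any other prime
        a Sylow subgroup that \<open>m\<close> centralizes.\<close>
      have "K \<subseteq> ?C"
      proof (rule subgroup_le_if_sylow_le[OF K(1) C])
        fix r :: nat assume r: "Factorial_Ring.prime r"
        show "\<exists>R \<in> sylow_subgroups (G\<lparr>carrier := K\<rparr>) r. R \<subseteq> ?C"
        proof (cases "r = q")
          case True
          have "Q \<subseteq> ?C"
            using mN normalizer_iff[OF Qs(1)] conj_subgroup_mem_iff[OF K(1) mG] Qs(2)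
              subgroup.mem_carrier[OF Qs(1)] by blast
          with Q True show ?thesis by blast
        next
          case False
          obtain R where R: "R \<in> sylow_subgroups (G\<lparr>carrier := K\<rparr>) r"
            using sylow_exists[OF r K(1)] .
          then have Rs: "subgroup R G" "R \<subseteq> K" "card R = r ^ multiplicity r (card K)"
            using sylow_restrict_iff[OF K(1)] by auto
          obtain T where T: "T \<in> sylow_subgroups G r" "R \<subseteq> T"
            using p_subgroup_le_sylow[OF r Rs(1,3)] .
          then have Ts: "subgroup T G" and Tc: "card T = r ^ multiplicity r (order G)"
            by (auto simp: sylow_subgroups_def)
          have TP: "T \<inter> P = {\<one>}"
            by (rule p_group_q_group_inter[OF r q False Ts Tc Ps Pc])
          have "y \<in> ?C" if y: "y \<in> R" for y
          proof -
            have yT: "y \<in> T" using y T(2) by blast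
            then have yG: "y \<in> carrier G" using subgroup.mem_carrier[OF Ts] by blast
            \<comment> \<open>The commutator of \<open>m\<close> and \<open>y\<close> lies in \<open>T\<close>, as \<open>m\<close> normalizes \<open>T\<close>, and in the normal
              \<open>q\<close>-subgroup.\<close>
            have "m \<in> normalizer G T"
              using ms(1) T(1) r by (auto simp: normalizer_inter_def)
            then have "m \<otimes> y \<otimes> inv m \<in> T"
              using yT normalizer_iff[OF Ts] by blast
            then have "m \<otimes> y \<otimes> inv m \<otimes> inv y \<in> T"
              using yT subgroup.m_closed[OF Ts] subgroup.m_inv_closed[OF Ts] by blast
            moreover have "m \<otimes> (y \<otimes> inv m \<otimes> inv y) \<in> ?N"
              using normal.inv_op_closed2[OF Nn yG subgroup.m_inv_closed[OF N ms(1)]]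
                subgroup.m_closed[OF N ms(1)] by blast
            then have "m \<otimes> y \<otimes> inv m \<otimes> inv y \<in> P"
              using NP[OF P(1)] mG yG by (auto simp: m_assoc)
            ultimately have "m \<otimes> y \<otimes> inv m \<otimes> inv y = \<one>"
              using TP by blast
            then have "m \<otimes> y \<otimes> inv m = y"
              using mG yG by (metis inv_closed inv_equality inv_inv m_closed)
            then show ?thesis
              using y yG Rs(2) conj_subgroup_mem_iff[OF K(1) mG] by auto
          qed
          with R show ?thesis by blast
        qed
      qed
      then have "m \<in> normalizer G K"
        using normalizer_iff[OF K(1)] conj_subgroup_mem_iff[OF K(1) mG] mG by blast
      then have mK: "m \<in> K \<inter> P"
        using K(2) ms(1) NP[OF P(1)] by blast
      \<comment> \<open>\<open>K \<inter> P\<close> is a \<open>q\<close>-subgroup of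
        \<open>K\<close> containing the Sylow subgroup \<open>Q\<close>, so it equals
        \<open>Q\<close>; but it contains \<open>m\<close>, which is not in
        \<open>Q\<close>.\<close>
      have KP: "subgroup (K \<inter> P) G" by (rule subgroups_Inter_pair[OF K(1) Ps])
      have "card (K \<inter> P) dvd q ^ multiplicity q (order G)"
        using card_subgroup_dvd[OF KP Ps] Pc by simp
      then obtain j where "card (K \<inter> P) = q ^ j"
        using q divides_primepow_nat by blast
      then have "K \<inter> P = Q"
        using Qs(2) P(2) by (intro sylow_maximal[OF q K(1) Q KP]) auto
      with mK mQ show False by blast
    qed
    \<comment> \<open>A Sylow \<open>q\<close>-subgroup of \<open>?Z\<close> normalizes every Sylow
      \<open>q\<close>-subgroup of \<open>G\<close>, hence lies in each of them and so in
      \<open>?N\<close>.\<close>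
    moreover obtain R where R: "R \<in> sylow_subgroups (G\<lparr>carrier := ?Z\<rparr>) q"
      using sylow_exists[OF q Zs] .
    moreover have "R \<subseteq> ?N"
    proof -
      have Rs: "subgroup R G" "R \<subseteq> ?Z" "card R = q ^ multiplicity q (card ?Z)"
        using R sylow_restrict_iff[OF Zs] by auto
      have "R \<subseteq> P" if P: "P \<in> sylow_subgroups G q" for P
      proof (rule p_subgroup_le_normal_sylow[OF q P Rs(1,3)])
        show "R \<subseteq> normalizer G P"
          using Rs(2) P q by (auto simp: normalizer_inter_def)
      qed
      with Rs(2) show ?thesis by blast
    qed
    ultimately show "\<exists>Q \<in> sylow_subgroups (G\<lparr>carrier := ?Z\<rparr>) q. Q \<subseteq> K" by blast
  qed
qed

section \<open>Comparing the intersections of normalizers\<close>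

text \<open>The second hypothesis asks for a member with a small normalizer rather than for
  \<open>P\<close> itself, so that it also covers the \<open>NE\<close>-subgroups, among which
  \<open>P\<close> need not occur.\<close>

lemma normalizer_inter_eq_sylow:
  assumes "\<Omega> \<subseteq> subnormalizer_subgroups G"
    and "\<And>q P. Factorial_Ring.prime q \<Longrightarrow> P \<in> sylow_subgroups G q \<Longrightarrow>
      \<exists>H \<in> \<Omega>. normalizer G H \<subseteq> normalizer G P"
  shows "normalizer_inter G \<Omega> =
    normalizer_inter G (\<Union>q \<in> {q. Factorial_Ring.prime q}. sylow_subgroups G q)" (is "_ = ?Z")
proof
  show "normalizer_inter G \<Omega> \<subseteq> ?Z"
    using assms(2) unfolding normalizer_inter_def by blast
  have "?Z \<subseteq> normalizer G H" if "H \<in> \<Omega>" for H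
  proof (rule sylow_normalizer_inter_le_self_normalizing)
    have H: "H \<in> subnormalizer_subgroups G" using assms(1) that by blast
    then show "subgroup (normalizer G H) G"
      by (simp add: subnormalizer_subgroups_def subgroup_normalizer)
    show "normalizer G (normalizer G H) \<subseteq> normalizer G H"
      by (simp add: normalizer_self_normalizing[OF H])
  qed
  then show "?Z \<subseteq> normalizer_inter G \<Omega>"
    by (auto simp: normalizer_inter_def)
qed

text \<open>The Sylow \<open>p\<close>-subgroups are themselves \<open>p\<close>-members, and
  conversely the normalizer of each \<open>p\<close>-member contains that of some Sylow
  \<open>p\<close>-subgroup.\<close>

lemma normalizer_inter_p_members_eq_sylow:
  assumes p: "Factorial_Ring.prime p"
    and "\<Omega> \<subseteq> subnormalizer_subgroups G" "sylow_subgroups G p \<subseteq> \<Omega>"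
  shows "normalizer_inter G (p_members p \<Omega>) = normalizer_inter G (sylow_subgroups G p)"
proof
  have "sylow_subgroups G p \<subseteq> p_members p \<Omega>"
    using assms(3) by (auto simp: p_members_def sylow_subgroups_def)
  then show "normalizer_inter G (p_members p \<Omega>) \<subseteq> normalizer_inter G (sylow_subgroups G p)"
    unfolding normalizer_inter_def by blast
  have "\<exists>P \<in> sylow_subgroups G p. normalizer G P \<subseteq> normalizer G H" if "H \<in> p_members p \<Omega>" for H
    using p_subnormalizer_normalizer[OF p] that assms(2) by (auto simp: p_members_def)
  then show "normalizer_inter G (sylow_subgroups G p) \<subseteq> normalizer_inter G (p_members p \<Omega>)"
    unfolding normalizer_inter_def by blast
qed

end

end

theorem theorem1p4:
  fixes G :: "('a, 'b) monoid_scheme" and p :: nat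
  assumes "group G" and "finite (carrier G)" and "Factorial_Ring.prime p"
  shows "(\<forall>\<Omega> \<in> {pronormal_subgroups G, scrH_subgroups G, weakly_normal_subgroups G,
                  subnormalizer_subgroups G, NE_subgroups G}.
            normalizer_inter G \<Omega> =
              normalizer_inter G (\<Union>q \<in> {q. Factorial_Ring.prime q}. sylow_subgroups G q))
       \<and> (\<forall>\<Omega> \<in> {pronormal_subgroups G, scrH_subgroups G, weakly_normal_subgroups G,
                  subnormalizer_subgroups G}.
            normalizer_inter G (p_members p \<Omega>) = normalizer_inter G (sylow_subgroups G p))"
proof -
  interpret group G by (rule assms(1))
  note fin = assms(2)
  let ?\<Omega> = "{pronormal_subgroups G, scrH_subgroups G, weakly_normal_subgroups G,
    subnormalizer_subgroups G}"
  have le: "\<Omega> \<subseteq> subnormalizer_subgroups G" if "\<Omega> \<in> insert (NE_subgroups G) ?\<Omega>" for \<Omega>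
    using that pronormal_le_weakly_normal scrH_le_weakly_normal[OF fin]
      weakly_normal_le_subnormalizer[OF fin] NE_le_scrH by blast
  have syl: "sylow_subgroups G q \<subseteq> \<Omega>" if "Factorial_Ring.prime q" "\<Omega> \<in> ?\<Omega>" for q \<Omega>
    using that sylow_pronormal[OF fin] sylow_scrH[OF fin] scrH_le_weakly_normal[OF fin]
      weakly_normal_le_subnormalizer[OF fin] by blast
  have "\<exists>H \<in> \<Omega>. normalizer G H \<subseteq> normalizer G P"
    if "\<Omega> \<in> insert (NE_subgroups G) ?\<Omega>" and q: "Factorial_Ring.prime q" and P: "P \<in> sylow_subgroups G q"
    for \<Omega> q P
  proof (cases "\<Omega> = NE_subgroups G")
    case True
    \<comment> \<open>The witness is \<open>normalizer G P\<close>: it is an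
      \<open>NE\<close>-subgroup and, being self-normalizing, has the same normalizer as
      \<open>P\<close>.\<close>
    have "P \<in> subnormalizer_subgroups G"
      using syl[OF q, of "subnormalizer_subgroups G"] P by blast
    then show ?thesis
      using True normalizer_mem_NE[OF fin] normalizer_self_normalizing[OF fin] by blast
  next
    case False
    then show ?thesis
      using that(1) syl[OF q, of \<Omega>] P by blast
  qed
  then have all: "normalizer_inter G \<Omega> =
      normalizer_inter G (\<Union>q \<in> {q. Factorial_Ring.prime q}. sylow_subgroups G q)"
    if "\<Omega> \<in> insert (NE_subgroups G) ?\<Omega>" for \<Omega>
    using that by (intro normalizer_inter_eq_sylow[OF fin le]) auto
  have p: "normalizer_inter G (p_members p \<Omega>) = normalizer_inter G (sylow_subgroups G p)"
    if "\<Omega> \<in> ?\<Omega>" for \<Omega>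
    using that assms(3) syl by (intro normalizer_inter_p_members_eq_sylow[OF fin _ le]) auto
  show ?thesis
    by (intro conjI ballI all p) (simp_all add: insert_commute)
qed

end
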